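(* Let $p$ be an odd prime. Then there is no DRAD difference set group of order $4p^2$; that is, no group $G$ of order $4p^2$ admits, for any $(v,k,\lambda)$, a $(v,k,\lambda)$ DRAD difference set $D\subset G$ with $D\neq\emptyset$ (for any subgroup $H$).
   Context: Let $G$ be a finite group. For $X\subseteq G$ put $X^{-1}=\{x^{-1}:x\in X\}$. A $(v,k,\lambda)$ difference set in $G$ is a subset $D\subset G$ with $|G|=v$, $|D|=k$, such that every element $1\neq g\in G$ occurs exactly $\lambda$ times in the multiset $\{xy^{-1}:x,y\in D\}$ (indexed by ordered pairs $(x,y)\in D\times D$). A $(v,k,\lambda)$ difference set $D$ is a $(v,k,\lambda)$ DRAD difference set with subgroup $H$ if $H$ is a normal subgroup of $G$ with $H\neq 1$ and (1) $D\cap D^{-1}=\emptyset$; (2) $G\setminus(D\cup D^{-1})=H$. The group $G$ is a DRAD difference set group if there is a DRAD difference set (with some subgroup $H$) in $G$. Difference sets are assumed nonempty (equivalently, for a DRAD difference set, $H\neq G$). *)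

theory Defs
  imports "HOL-Algebra.Algebra" "HOL-Computational_Algebra.Primes"
begin

text \<open>Difference sets are nonempty by convention. The cardinality in the last conjunct is the
  multiplicity of \<open>g\<close> in the multiset of all quotients \<open>x y\<^sup>-\<^sup>1\<close> indexed by
  ordered pairs from \<open>D \<times> D\<close>.\<close>

definition difference_set ::
  "('a, 'b) monoid_scheme \<Rightarrow> nat \<Rightarrow> nat \<Rightarrow> nat \<Rightarrow> 'a set \<Rightarrow> bool" where
  "difference_set G v k l D \<longleftrightarrow>
     group G \<and> finite (carrier G) \<and> D \<subseteq> carrier G \<and> D \<noteq> {} \<and>
     Coset.order G = v \<and> card D = k \<and>
     (\<forall>g \<in> carrier G. g \<noteq> \<one>\<^bsub>G\<^esub> \<longrightarrow>
        card {(x, y). x \<in> D \<and> y \<in> D \<and> x \<otimes>\<^bsub>G\<^esub> inv\<^bsub>G\<^esub> y = g} = l)"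

definition DRAD_difference_set ::
  "('a, 'b) monoid_scheme \<Rightarrow> nat \<Rightarrow> nat \<Rightarrow> nat \<Rightarrow> 'a set \<Rightarrow> 'a set \<Rightarrow> bool" where
  "DRAD_difference_set G v k l H D \<longleftrightarrow>
     difference_set G v k l D \<and>
     H \<lhd> G \<and> H \<noteq> {\<one>\<^bsub>G\<^esub>} \<and>
     D \<inter> set_inv\<^bsub>G\<^esub> D = {} \<and>
     carrier G - (D \<union> set_inv\<^bsub>G\<^esub> D) = H"

definition DRAD_difference_set_group :: "('a, 'b) monoid_scheme \<Rightarrow> bool" where
  "DRAD_difference_set_group G \<longleftrightarrow> (\<exists>v k l H D. DRAD_difference_set G v k l H D)"

end

theory Submission
  imports Defs
begin

text \<open>
  Let \<open>D\<close> be a DRAD difference set in \<open>G\<close> with subgroup \<open>H\<close>, and let \<open>s\<close> be the function that is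
  \<open>1\<close> on \<open>D\<close>, \<open>-1\<close> on the set of inverses of \<open>D\<close> and \<open>0\<close> on \<open>H\<close>. Everything is read off from the
  autocorrelation \<open>corr g = (\<Sum>c. s c * s (g c))\<close>.

  For \<open>g \<noteq> 1\<close> the value \<open>corr g\<close> is a constant, diminished by \<open>|H|\<close> if \<open>g \<in> H\<close>. As \<open>s\<close> is odd under
  inversion, \<open>corr\<close> sums to \<open>0\<close> over \<open>G\<close>; together with \<open>|H|\<close> dividing \<open>|G|\<close> this forces
  \<open>|G| = |H|\<^sup>2\<close> and makes the constant \<open>0\<close> (lemmas \<open>order_eq_square\<close>, \<open>corr_eq\<close>). It follows that the
  squares of the sums of \<open>s\<close> over the cosets of \<open>H\<close> add up to \<open>0\<close>, so that \<open>s\<close> sums to \<open>0\<close> over every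
  coset of \<open>H\<close> (lemma \<open>sum_s_coset\<close>).

  Now let \<open>|G| = 4p\<^sup>2\<close>, so \<open>|H| = 2p\<close>. If \<open>M\<close> is a Sylow \<open>p\<close>-subgroup, of order \<open>p\<^sup>2\<close>, then
  \<open>K = M \<inter> H\<close> has order \<open>p\<close> and is normal in \<open>G\<close>. Let \<open>r a\<close> be the sum of \<open>s\<close> over the coset \<open>Ka\<close>.
  This function is \<open>0\<close> on \<open>H\<close> and odd elsewhere, changes sign under \<open>a \<mapsto> a\<^sup>-\<^sup>1\<close> and under
  \<open>a \<mapsto> az\<close> for \<open>z \<in> H - K\<close>, and has autocorrelation \<open>0\<close> at every \<open>g \<notin> H\<close> (lemma \<open>corr_r\<close>).
  There is a set \<open>R\<close>, a union of two right cosets of \<open>M\<close>, such that \<open>G\<close> is the disjoint union of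
  \<open>R\<close> and \<open>Rz\<close> and \<open>R \<inter> H = K\<close> (lemma \<open>obtain_half\<close>). Hence \<open>\<Sum>c\<in>R. r c * r (g c) = 0\<close> for \<open>g \<in> M - K\<close>.
  But \<open>ab \<equiv> a + b - 1\<close> modulo \<open>4\<close> for odd \<open>a\<close>, \<open>b\<close>, and since \<open>gR = R\<close> the sum becomes computable
  modulo \<open>4\<close>: up to the contribution of the \<open>2p\<close> terms with \<open>c \<in> K\<close> or \<open>gc \<in> K\<close> it is
  \<open>2 (\<Sum>c\<in>R. r c) - |R|\<close>, and altogether it is congruent to \<open>2\<close>, a contradiction.
\<close>

section \<open>Sums over a finite group\<close>

context group
begin

lemma sum_left_mult:
  assumes "x \<in> carrier G"
  shows "(\<Sum>c\<in>carrier G. f (x \<otimes> c)) = (\<Sum>c\<in>carrier G. f c)"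
  using assms
  by (intro sum.reindex_bij_witness[of _ "\<lambda>c. inv x \<otimes> c" "\<lambda>c. x \<otimes> c"])
     (auto simp: m_assoc[symmetric])

lemma sum_inv:
  "(\<Sum>c\<in>carrier G. f (inv c)) = (\<Sum>c\<in>carrier G. f c)"
  by (intro sum.reindex_bij_witness[of _ "\<lambda>c. inv c" "\<lambda>c. inv c"]) auto

lemma sum_subgroup_right_mult:
  assumes "subgroup H G" "x \<in> H"
  shows "(\<Sum>c\<in>H. f (c \<otimes> x)) = (\<Sum>c\<in>H. f c)"
proof -
  interpret H: subgroup H G by fact
  show ?thesis using assms(2)
    by (intro sum.reindex_bij_witness[of _ "\<lambda>c. c \<otimes> inv x" "\<lambda>c. c \<otimes> x"])
       (auto simp: m_assoc)
qed

end

section \<open>The autocorrelation of a DRAD difference set\<close>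

text \<open>A group with a DRAD difference set.\<close>

locale drad = group G for G (structure) +
  fixes v k l :: nat and H D :: "'a set"
  assumes DRAD: "DRAD_difference_set G v k l H D"
begin

lemma fin: "finite (carrier G)"
  and D_subset: "D \<subseteq> carrier G"
  and D_nonempty: "D \<noteq> {}"
  and order_v: "card (carrier G) = v"
  and card_D: "card D = k"
  and card_quot: "\<And>g. g \<in> carrier G \<Longrightarrow> g \<noteq> \<one> \<Longrightarrow>
    card {(x, y). x \<in> D \<and> y \<in> D \<and> x \<otimes> inv y = g} = l"
  and H_normal: "H \<lhd> G"
  and H_nontrivial: "H \<noteq> {\<one>}"
  and H_complement: "carrier G - (D \<union> set_inv D) = H"
  using DRAD unfolding DRAD_difference_set_def difference_set_def Coset.order_def by auto

sublocale H: normal H G by (rule H_normal)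

lemma finite_H: "finite H"
  using H.subset fin finite_subset by blast

lemma inv_notin_D: "a \<in> D \<Longrightarrow> inv a \<notin> D"
  using DRAD unfolding DRAD_difference_set_def SET_INV_def by blast

lemma in_D_cases:
  assumes "a \<in> carrier G"
  shows "a \<in> D \<or> inv a \<in> D \<or> a \<in> H"
proof -
  have "inv a \<in> D" if "a \<in> set_inv D"
    using that D_subset unfolding SET_INV_def by auto
  thus ?thesis using assms H_complement by blast
qed

lemma notin_H: "a \<in> D \<Longrightarrow> a \<notin> H" "inv a \<in> D \<Longrightarrow> a \<in> carrier G \<Longrightarrow> a \<notin> H"
  using H_complement D_subset unfolding SET_INV_def by force+

lemma H_swap:
  assumes "a \<in> carrier G" "b \<in> carrier G" "a \<otimes> b \<in> H"
  shows "b \<otimes> a \<in> H"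
proof -
  have "inv a \<otimes> (a \<otimes> b) \<otimes> a \<in> H"
    using assms H.inv_op_closed1 by blast
  thus ?thesis using assms by (simp add: m_assoc[symmetric])
qed

lemma H_mult_inv:
  assumes "a \<in> carrier G" "b \<in> carrier G" "a \<otimes> inv b \<in> H"
  shows "inv a \<otimes> b \<in> H"
proof -
  have "inv (a \<otimes> inv b) \<in> H" using assms by blast
  hence "b \<otimes> inv a \<in> H" using assms by (simp add: inv_mult_group)
  thus ?thesis using assms H_swap by blast
qed

text \<open>The difference of the indicator functions of \<open>D\<close> and of its set of inverses.\<close>

definition s :: "'a \<Rightarrow> int" where
  "s a = of_bool (a \<in> D) - of_bool (inv a \<in> D)"

lemma s_inv: "a \<in> carrier G \<Longrightarrow> s (inv a) = - s a"
  by (simp add: s_def)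

lemma s_on_H: "a \<in> H \<Longrightarrow> s a = 0"
  using notin_H H.subset by (auto simp: s_def)

lemma odd_s: "a \<in> carrier G \<Longrightarrow> a \<notin> H \<Longrightarrow> odd (s a)"
  using in_D_cases[of a] inv_notin_D[of a] by (auto simp: s_def)

lemma s_eq: "a \<in> carrier G \<Longrightarrow> s a = 2 * of_bool (a \<in> D) - 1 + of_bool (a \<in> H)"
  using in_D_cases[of a] inv_notin_D[of a] notin_H[of a] by (auto simp: s_def)

text \<open>The autocorrelation of \<open>s\<close> with respect to left translation.\<close>

definition corr :: "'a \<Rightarrow> int" where
  "corr g = (\<Sum>c\<in>carrier G. s c * s (g \<otimes> c))"

lemma corr_double_shift:
  assumes "x \<in> carrier G" "y \<in> carrier G"
  shows "(\<Sum>c\<in>carrier G. s (x \<otimes> c) * s (y \<otimes> c)) = corr (y \<otimes> inv x)"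
proof -
  have "corr (y \<otimes> inv x) = (\<Sum>c\<in>carrier G. s (x \<otimes> c) * s (y \<otimes> inv x \<otimes> (x \<otimes> c)))"
    unfolding corr_def using sum_left_mult[OF assms(1), of "\<lambda>c. s c * s (y \<otimes> inv x \<otimes> c)"] by simp
  also have "\<dots> = (\<Sum>c\<in>carrier G. s (x \<otimes> c) * s (y \<otimes> c))"
    by (intro sum.cong refl arg_cong2[of _ _ _ _ "(*)"] arg_cong[of _ _ s])
       (use assms in \<open>simp add: m_assoc inv_solve_left'\<close>)
  finally show ?thesis by simp
qed

lemma sum_indicator: "A \<subseteq> carrier G \<Longrightarrow> (\<Sum>c\<in>carrier G. of_bool (c \<in> A)) = int (card A)"
  using fin by (simp add: Int_absorb1 flip: of_nat_sum)

lemma sum_D_D: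
  assumes "g \<in> carrier G" "g \<noteq> \<one>"
  shows "(\<Sum>c\<in>carrier G. of_bool (c \<in> D) * of_bool (g \<otimes> c \<in> D)) = int l"
proof -
  have "bij_betw (\<lambda>c. (g \<otimes> c, c)) {c\<in>carrier G. c \<in> D \<and> g \<otimes> c \<in> D}
          {(x, y). x \<in> D \<and> y \<in> D \<and> x \<otimes> inv y = g}"
    using assms D_subset
    by (intro bij_betw_byWitness[where f' = snd]) (auto simp: m_assoc subset_iff)
  from bij_betw_same_card[OF this] have "card {c\<in>carrier G. c \<in> D \<and> g \<otimes> c \<in> D} = l"
    using card_quot[OF assms] by simp
  moreover have "(\<Sum>c\<in>carrier G. of_bool (c \<in> D) * of_bool (g \<otimes> c \<in> D))
      = (\<Sum>c\<in>carrier G. of_bool (c \<in> {c\<in>carrier G. c \<in> D \<and> g \<otimes> c \<in> D}) :: int)"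
    by (intro sum.cong) auto
  ultimately show ?thesis using sum_indicator[of "{c\<in>carrier G. c \<in> D \<and> g \<otimes> c \<in> D}"] by auto
qed

lemma sum_H_H:
  assumes "g \<in> carrier G"
  shows "(\<Sum>c\<in>carrier G. of_bool (c \<in> H) * of_bool (g \<otimes> c \<in> H)) = of_bool (g \<in> H) * int (card H)"
proof -
  have "g \<otimes> c \<in> H \<longleftrightarrow> g \<in> H" if "c \<in> H" for c
    using that assms
    by (metis H.m_closed H.m_inv_closed H.mem_carrier inv_closed inv_solve_right m_closed)
  hence "(\<Sum>c\<in>carrier G. of_bool (c \<in> H) * of_bool (g \<otimes> c \<in> H))
      = (\<Sum>c\<in>carrier G. of_bool (g \<in> H) * of_bool (c \<in> H) :: int)"
    by (intro sum.cong) auto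
  thus ?thesis using sum_indicator[OF H.subset] by (simp flip: sum_distrib_left)
qed

text \<open>The substitution \<open>c \<mapsto> (g c)\<^sup>-\<^sup>1\<close> in the second sum, with normality of \<open>H\<close>, turns the total into
  the number of \<open>c \<in> H\<close> such that \<open>g c\<close> or its inverse lies in \<open>D\<close>, that is, such that
  \<open>g c \<notin> H\<close>.\<close>

lemma sum_H_D:
  assumes g: "g \<in> carrier G"
  shows "(\<Sum>c\<in>carrier G. of_bool (c \<in> H) * of_bool (g \<otimes> c \<in> D))
       + (\<Sum>c\<in>carrier G. of_bool (c \<in> D) * of_bool (g \<otimes> c \<in> H))
       = int (card H) * (1 - of_bool (g \<in> H))" (is "?A + ?B = _")
proof -
  have *: "g \<otimes> inv c \<in> H \<longleftrightarrow> inv g \<otimes> c \<in> H" if "c \<in> carrier G" for c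
    using that g H_mult_inv[of g c] H_mult_inv[of "inv g" "inv c"] by auto
  have "?B = (\<Sum>c\<in>carrier G. of_bool (inv c \<in> D) * of_bool (g \<otimes> inv c \<in> H))"
    using sum_inv[of "\<lambda>c. of_bool (c \<in> D) * of_bool (g \<otimes> c \<in> H) :: int"] by simp
  also have "\<dots> = (\<Sum>c\<in>carrier G. of_bool (inv c \<in> D) * of_bool (inv g \<otimes> c \<in> H))"
    using * by (intro sum.cong) auto
  also have "\<dots> = (\<Sum>c\<in>carrier G. of_bool (inv (g \<otimes> c) \<in> D) * of_bool (inv g \<otimes> (g \<otimes> c) \<in> H))"
    using sum_left_mult[OF g, of "\<lambda>c. of_bool (inv c \<in> D) * of_bool (inv g \<otimes> c \<in> H) :: int"] by simp
  also have "\<dots> = (\<Sum>c\<in>carrier G. of_bool (inv (g \<otimes> c) \<in> D) * of_bool (c \<in> H))"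
    using g by (intro sum.cong) (auto simp flip: m_assoc)
  finally have "?A + ?B = (\<Sum>c\<in>carrier G.
      of_bool (c \<in> H) * (of_bool (g \<otimes> c \<in> D) + of_bool (inv (g \<otimes> c) \<in> D)))"
    by (simp add: sum.distrib algebra_simps)
  also have "\<dots> = (\<Sum>c\<in>carrier G. of_bool (c \<in> H) - of_bool (c \<in> H) * of_bool (g \<otimes> c \<in> H))"
  proof (intro sum.cong refl)
    fix c assume "c \<in> carrier G"
    hence "g \<otimes> c \<in> carrier G" using g by simp
    thus "of_bool (c \<in> H) * (of_bool (g \<otimes> c \<in> D) + of_bool (inv (g \<otimes> c) \<in> D))
        = (of_bool (c \<in> H) - of_bool (c \<in> H) * of_bool (g \<otimes> c \<in> H) :: int)"
      using in_D_cases[of "g \<otimes> c"] inv_notin_D[of "g \<otimes> c"] notin_H[of "g \<otimes> c"] by auto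
  qed
  also have "\<dots> = int (card H) * (1 - of_bool (g \<in> H))"
    unfolding sum_subtractf sum_H_H[OF g] sum_indicator[OF H.subset] by (simp add: algebra_simps)
  finally show ?thesis .
qed

lemma corr_nontrivial:
  assumes g: "g \<in> carrier G" "g \<noteq> \<one>"
  shows "corr g = 4 * int l - 4 * int k + int v - of_bool (g \<in> H) * int (card H)"
proof -
  let ?d = "\<lambda>c. of_bool (c \<in> D) :: int" and ?e = "\<lambda>c. of_bool (c \<in> H) :: int"
  have shift: "(\<Sum>c\<in>carrier G. f (g \<otimes> c)) = (\<Sum>c\<in>carrier G. f c)" for f :: "'a \<Rightarrow> int"
    by (rule sum_left_mult[OF g(1)])
  have "corr g = (\<Sum>c\<in>carrier G. 4 * (?d c * ?d (g \<otimes> c)) - 2 * ?d c - 2 * ?d (g \<otimes> c)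
      + 2 * (?e c * ?d (g \<otimes> c) + ?d c * ?e (g \<otimes> c)) + 1 - ?e c - ?e (g \<otimes> c)
      + ?e c * ?e (g \<otimes> c))"
    unfolding corr_def using g by (intro sum.cong refl) (simp add: s_eq algebra_simps)
  also have "\<dots> = 4 * (\<Sum>c\<in>carrier G. ?d c * ?d (g \<otimes> c)) - 2 * (\<Sum>c\<in>carrier G. ?d c)
      - 2 * (\<Sum>c\<in>carrier G. ?d (g \<otimes> c))
      + 2 * ((\<Sum>c\<in>carrier G. ?e c * ?d (g \<otimes> c)) + (\<Sum>c\<in>carrier G. ?d c * ?e (g \<otimes> c)))
      + int v - (\<Sum>c\<in>carrier G. ?e c) - (\<Sum>c\<in>carrier G. ?e (g \<otimes> c))
      + (\<Sum>c\<in>carrier G. ?e c * ?e (g \<otimes> c))"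
    by (simp only: sum.distrib sum_subtractf sum_constant order_v mult_1_right
        flip: sum_distrib_left)
  also have "\<dots> = 4 * int l - 2 * int k - 2 * int k + 2 * (int (card H) * (1 - of_bool (g \<in> H)))
      + int v - int (card H) - int (card H) + of_bool (g \<in> H) * int (card H)"
    unfolding shift[of ?d] shift[of ?e]
    by (simp only: sum_D_D[OF g] sum_H_D[OF g(1)] sum_H_H[OF g(1)] sum_indicator[OF D_subset]
        sum_indicator[OF H.subset] card_D)
  finally show ?thesis by (simp add: algebra_simps)
qed

lemma corr_one: "corr \<one> = int v - int (card H)"
proof -
  have "corr \<one> = (\<Sum>c\<in>carrier G. 1 - of_bool (c \<in> H))"
    unfolding corr_def
  proof (intro sum.cong refl)
    fix c assume "c \<in> carrier G"
    thus "s c * s (\<one> \<otimes> c) = 1 - of_bool (c \<in> H)"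
      using in_D_cases[of c] inv_notin_D[of c] notin_H[of c] by (auto simp: s_def)
  qed
  thus ?thesis by (simp add: sum_subtractf sum_indicator[OF H.subset] order_v)
qed

lemma sum_s: "(\<Sum>c\<in>carrier G. s c) = 0"
proof -
  have "(\<Sum>c\<in>carrier G. s c) = (\<Sum>c\<in>carrier G. s (inv c))"
    by (simp add: sum_inv)
  also have "\<dots> = - (\<Sum>c\<in>carrier G. s c)"
    by (simp add: s_inv sum_negf)
  finally show ?thesis by simp
qed

lemma sum_corr: "(\<Sum>g\<in>carrier G. corr g) = 0"
proof -
  have "(\<Sum>g\<in>carrier G. corr g) = (\<Sum>c\<in>carrier G. s c * (\<Sum>g\<in>carrier G. s (g \<otimes> c)))"
    unfolding corr_def by (subst sum.swap) (simp add: sum_distrib_left)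
  also have "\<dots> = 0"
  proof (rule sum.neutral, rule ballI)
    fix c assume "c \<in> carrier G"
    hence "(\<Sum>g\<in>carrier G. s (g \<otimes> c)) = (\<Sum>g\<in>carrier G. s g)"
      by (rule sum_subgroup_right_mult[OF subgroup_self])
    thus "s c * (\<Sum>g\<in>carrier G. s (g \<otimes> c)) = 0" by (simp add: sum_s)
  qed
  finally show ?thesis .
qed

text \<open>This expresses that the values of \<open>corr\<close> add up to \<open>0\<close>.\<close>

lemma order_minus_card_H_square:
  "int v - int (card H) ^ 2 = (int v - 1) * (4 * int k - 4 * int l - int v)"
proof -
  define t where "t = 4 * int k - 4 * int l - int v"
  have "corr g = (- t) + (if g = \<one> then int v + t else 0) - of_bool (g \<in> H) * int (card H)"
    if "g \<in> carrier G" for g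
    using that corr_nontrivial[of g] corr_one by (auto simp: t_def)
  hence "0 = (\<Sum>g\<in>carrier G. (- t) + (if g = \<one> then int v + t else 0) - of_bool (g \<in> H) * int (card H))"
    using sum_corr by simp
  also have "\<dots> = int v * (- t) + (int v + t) - int (card H) * int (card H)"
    using fin by (simp add: sum.distrib sum_subtractf order_v sum_indicator[OF H.subset]
        flip: sum_distrib_right)
  finally show ?thesis by (simp add: t_def algebra_simps power2_eq_square)
qed

lemma card_H_less: "card H < v"
proof -
  have "H \<subset> carrier G" using D_nonempty D_subset notin_H(1) H.subset by blast
  thus ?thesis using psubset_card_mono[OF fin] order_v by blast
qed

lemma card_H_gt_1: "1 < card H"
proof -
  have "{\<one>} \<subset> H" using H_nontrivial H.one_closed by blast
  from psubset_card_mono[OF finite_H this] show ?thesis by simp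
qed

lemma order_eq_square: "v = card H ^ 2" and multiplicity_eq: "4 * int k - 4 * int l - int v = 0"
proof -
  define h t where "h = int (card H)" and "t = 4 * int k - 4 * int l - int v"
  obtain m where m: "v = card H * m"
    using lagrange[OF H.is_subgroup] order_v by (metis Coset.order_def mult.commute)
  have h: "h > 1" "h < int v" using card_H_gt_1 card_H_less by (auto simp: h_def)
  have vm: "int v = h * int m" by (simp add: m h_def)
  have eq: "int v - h ^ 2 = (int v - 1) * t" using order_minus_card_H_square by (simp add: h_def t_def)
  have "h * (h - int m) = h * (- int m * t) + t"
    using eq vm by (simp add: algebra_simps power2_eq_square)
  hence "t = h * (h - int m + int m * t)" by (simp add: algebra_simps)
  then obtain q where q: "t = h * q" by blast
  \<comment> \<open>\<open>(v - 1) (1 - t) = h\<^sup>2 - 1 > 0\<close> gives \<open>t \<le> 0\<close>; as \<open>h\<close> divides \<open>t\<close>, a nonzero \<open>t\<close> would be at most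
    \<open>-h\<close> and make the left-hand side too large.\<close>
  have "t = 0"
  proof (rule ccontr)
    assume "t \<noteq> 0"
    have "(int v - 1) * (1 - t) = h ^ 2 - 1" using eq by (simp add: algebra_simps)
    moreover have "h ^ 2 - 1 > 0" using h by simp
    ultimately have "0 < (int v - 1) * (1 - t)" by simp
    hence "t < 0" using h \<open>t \<noteq> 0\<close> by (simp add: zero_less_mult_iff)
    hence "q \<le> -1" using q h by (simp add: mult_less_0_iff)
    hence "t \<le> - h" using q h mult_left_mono[of q "-1" h] by simp
    hence "(int v - 1) * (1 - t) \<ge> (int v - 1) * (1 + h)"
      using h by (intro mult_left_mono) auto
    moreover have "(int v - 1) * (1 + h) > (h - 1) * (1 + h)"
      using h by (intro mult_strict_right_mono) auto
    moreover have "(h - 1) * (1 + h) = h ^ 2 - 1" by (simp add: algebra_simps power2_eq_square)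
    ultimately show False using \<open>(int v - 1) * (1 - t) = h ^ 2 - 1\<close> by linarith
  qed
  thus "4 * int k - 4 * int l - int v = 0" by (simp add: t_def)
  have "int v = int (card H ^ 2)" using eq \<open>t = 0\<close> by (simp add: h_def)
  thus "v = card H ^ 2" by (simp only: of_nat_eq_iff)
qed

lemma corr_eq:
  assumes "g \<in> carrier G"
  shows "corr g = of_bool (g = \<one>) * int v - of_bool (g \<in> H) * int (card H)"
  using corr_nontrivial[OF assms] corr_one multiplicity_eq by (cases "g = \<one>") auto

text \<open>\<open>D\<close> meets every nontrivial coset of \<open>H\<close> in exactly half of its elements.\<close>

lemma sum_s_coset:
  assumes a: "a \<in> carrier G"
  shows "(\<Sum>x\<in>H. s (x \<otimes> a)) = 0"
proof -
  have "(\<Sum>a\<in>carrier G. (\<Sum>x\<in>H. s (x \<otimes> a)) ^ 2)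
      = (\<Sum>a\<in>carrier G. \<Sum>x\<in>H. \<Sum>y\<in>H. s (x \<otimes> a) * s (y \<otimes> a))"
    by (simp only: power2_eq_square sum_product)
  also have "\<dots> = (\<Sum>x\<in>H. \<Sum>a\<in>carrier G. \<Sum>y\<in>H. s (x \<otimes> a) * s (y \<otimes> a))"
    by (rule sum.swap)
  also have "\<dots> = (\<Sum>x\<in>H. \<Sum>y\<in>H. \<Sum>a\<in>carrier G. s (x \<otimes> a) * s (y \<otimes> a))"
    by (rule sum.cong[OF refl], rule sum.swap)
  also have "\<dots> = (\<Sum>x\<in>H. \<Sum>y\<in>H. corr (y \<otimes> inv x))"
    by (rule sum.cong[OF refl], rule sum.cong[OF refl], rule corr_double_shift) auto
  also have "\<dots> = (\<Sum>x\<in>H. \<Sum>y\<in>H. corr y)"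
    by (rule sum.cong[OF refl], rule sum_subgroup_right_mult[OF H.is_subgroup]) auto
  also have "(\<Sum>y\<in>H. corr y) = (\<Sum>y\<in>H. (if y = \<one> then int v else 0) - int (card H))"
    by (intro sum.cong refl) (auto simp: corr_eq)
  also have "\<dots> = 0"
    using finite_H H.one_closed by (simp add: sum_subtractf order_eq_square power2_eq_square)
  finally have "(\<Sum>a\<in>carrier G. (\<Sum>x\<in>H. s (x \<otimes> a)) ^ 2) = 0" by simp
  thus ?thesis using a fin by (simp add: sum_nonneg_eq_0_iff)
qed

end


section \<open>Order four times the square of an odd prime\<close>

lemma (in group) card_subgroup_dvd:
  assumes "subgroup A G" "subgroup B G" "A \<subseteq> B" "finite B"
  shows "card A dvd card B"
proof -
  interpret B: group "G\<lparr>carrier := B\<rparr>" using subgroup_imp_group[OF assms(2)] .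
  have "subgroup A (G\<lparr>carrier := B\<rparr>)" using subgroup_incl assms(1-3) by blast
  from B.lagrange[OF this] have "card (rcosets\<^bsub>G\<lparr>carrier := B\<rparr>\<^esub> A) * card A = card B"
    by (simp add: Coset.order_def)
  from this[symmetric] show ?thesis by simp
qed

lemma (in group) subgroup_pow_closed:
  assumes "subgroup A G" "x \<in> A"
  shows "x [^] (n :: nat) \<in> A"
proof -
  interpret A: subgroup A G by fact
  show ?thesis using assms(2) by (induction n) auto
qed

lemma (in group) subgroup_pow_card:
  assumes "subgroup A G" "finite A" "x \<in> A"
  shows "x [^] card A = \<one>"
proof -
  interpret A: group "G\<lparr>carrier := A\<rparr>" using subgroup_imp_group[OF assms(1)] .
  show ?thesis using A.pow_order_eq_1[of x] assms
    by (simp add: Coset.order_def nat_pow_consistent[symmetric])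
qed

lemma (in group) notin_rcos:
  assumes "subgroup A G" "x \<in> carrier G" "x \<notin> A" "a \<in> A"
  shows "a \<otimes> x \<notin> A"
proof
  interpret A: subgroup A G by fact
  assume "a \<otimes> x \<in> A"
  hence "inv a \<otimes> (a \<otimes> x) \<in> A" using assms by blast
  thus False using assms A.subset by (simp add: m_assoc[symmetric])
qed

lemma (in group) card_mult_le:
  assumes "subgroup A G" "subgroup B G" "A \<inter> B = {\<one>}" "finite (carrier G)"
  shows "card A * card B \<le> card (carrier G)"
proof -
  interpret A: subgroup A G by fact
  interpret B: subgroup B G by fact
  have "inj_on (\<lambda>(a, b). a \<otimes> b) (A \<times> B)"
  proof (rule inj_onI, clarify)
    fix a b a' b' assume *: "a \<in> A" "b \<in> B" "a' \<in> A" "b' \<in> B" "a \<otimes> b = a' \<otimes> b'"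
    have "a = a \<otimes> b \<otimes> inv b" using *(1-4) by (simp add: m_assoc)
    also have "\<dots> = a' \<otimes> (b' \<otimes> inv b)" unfolding *(5) using *(1-4) by (simp add: m_assoc)
    finally have eq: "inv a' \<otimes> a = b' \<otimes> inv b" using *(1-4) by (simp add: m_assoc[symmetric])
    have "inv a' \<otimes> a \<in> A" "b' \<otimes> inv b \<in> B" using *(1-4) by auto
    hence "inv a' \<otimes> a \<in> A \<inter> B" using eq by simp
    hence "inv a' \<otimes> a = \<one>" "b' \<otimes> inv b = \<one>" using assms(3) eq by auto
    moreover have "a = a' \<otimes> (inv a' \<otimes> a)" "b' = (b' \<otimes> inv b) \<otimes> b"
      using *(1-4) by (simp_all add: m_assoc, simp_all add: m_assoc[symmetric])
    ultimately show "a = a' \<and> b = b'" using *(1-4) by simp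
  qed
  moreover have "(\<lambda>(a, b). a \<otimes> b) ` (A \<times> B) \<subseteq> carrier G" by auto
  ultimately have "card (A \<times> B) \<le> card (carrier G)"
    using card_inj_on_le assms(4) by blast
  thus ?thesis by (simp add: card_cartesian_product)
qed

text \<open>A DRAD difference set in a group of order \<open>4p\<^sup>2\<close>, with a chosen Sylow \<open>p\<close>-subgroup \<open>M\<close>.\<close>

locale drad_four_p_square = drad +
  fixes p :: nat and M :: "'a set"
  assumes prime_p: "Factorial_Ring.prime p" and odd_p: "odd p" and v_p: "v = 4 * p ^ 2"
    and M_subgroup: "subgroup M G" and card_M: "card M = p ^ 2"
begin

sublocale M: subgroup M G by (rule M_subgroup)

lemma p_gt_2: "p > 2"
  using prime_p odd_p prime_ge_2_nat[of p] by (cases "p = 2") auto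

lemma finite_M: "finite M"
  using M.subset fin finite_subset by blast

lemma card_H: "card H = 2 * p"
proof -
  have "card H ^ 2 = (2 * p) ^ 2" using order_eq_square v_p by (simp add: power_mult_distrib)
  thus ?thesis by (simp only: power2_eq_iff_nonneg zero_le)
qed

text \<open>The subgroup of index \<open>2\<close> in \<open>H\<close>.\<close>

definition K :: "'a set" where "K = M \<inter> H"

lemma K_subgroup: "subgroup K G"
  unfolding K_def using subgroups_Inter_pair[OF M_subgroup H.is_subgroup] .

sublocale K: subgroup K G by (rule K_subgroup)

lemma finite_K: "finite K"
  using finite_M by (simp add: K_def)

lemma K_sub_H: "x \<in> K \<Longrightarrow> x \<in> H" and K_sub_M: "x \<in> K \<Longrightarrow> x \<in> M"
  by (auto simp: K_def)

lemma card_K: "card K = p"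
proof -
  have "card K dvd p ^ 2"
    using card_subgroup_dvd[OF K_subgroup M_subgroup _ finite_M] card_M by (auto simp: K_def)
  then obtain i where i: "i \<le> 2" "card K = p ^ i"
    using divides_primepow_nat[OF prime_p] by blast
  have dvd: "card K dvd 2 * p"
    using card_subgroup_dvd[OF K_subgroup H.is_subgroup _ finite_H] card_H by (auto simp: K_def)
  have "i \<noteq> 0"
  proof
    assume "i = 0"
    hence "card K = 1" using i by simp
    hence "M \<inter> H = {\<one>}" using K.one_closed unfolding K_def by (metis card_1_singletonE singletonD)
    hence "p ^ 2 * (2 * p) \<le> 4 * p ^ 2"
      using card_mult_le[OF M_subgroup H.is_subgroup _ fin] card_M card_H order_v v_p by simp
    hence "p ^ 2 * (2 * p) \<le> p ^ 2 * 4" by (simp add: mult.commute)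
    hence "2 * p \<le> 4" using p_gt_2 by (simp only: mult_le_cancel1) auto
    thus False using p_gt_2 by simp
  qed
  moreover have "i \<noteq> 2"
  proof
    assume "i = 2"
    hence "p * p dvd 2 * p" using dvd i by (simp add: power2_eq_square)
    hence "p dvd 2" using p_gt_2 by simp
    thus False using p_gt_2 by (auto dest: dvd_imp_le)
  qed
  ultimately have "i = 1" using i(1) by simp
  thus ?thesis using i(2) by simp
qed

lemma H_eq_two_cosets:
  assumes "z \<in> H" "z \<notin> K"
  shows "H = K \<union> (\<lambda>x. x \<otimes> z) ` K" "K \<inter> (\<lambda>x. x \<otimes> z) ` K = {}" "inj_on (\<lambda>x. x \<otimes> z) K"
proof -
  have z: "z \<in> carrier G" using assms by auto
  show disj: "K \<inter> (\<lambda>x. x \<otimes> z) ` K = {}"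
    using notin_rcos[OF K_subgroup z assms(2)] by auto
  show inj: "inj_on (\<lambda>x. x \<otimes> z) K"
    using inj_on_multc[OF z] K.subset inj_on_subset by blast
  have "card (K \<union> (\<lambda>x. x \<otimes> z) ` K) = card H"
    using card_Un_disjoint[OF finite_K _ disj] finite_K card_image[OF inj] card_K card_H by simp
  moreover have "K \<union> (\<lambda>x. x \<otimes> z) ` K \<subseteq> H" using K_sub_H assms by auto
  ultimately show "H = K \<union> (\<lambda>x. x \<otimes> z) ` K"
    using card_subset_eq[OF finite_H] by metis
qed

lemma square_in_K:
  assumes "h \<in> H"
  shows "h \<otimes> h \<in> K"
proof (cases "h \<in> K")
  case False
  show ?thesis
  proof (rule ccontr)
    assume "h \<otimes> h \<notin> K"
    hence "h \<otimes> h \<in> (\<lambda>x. x \<otimes> h) ` K" using H_eq_two_cosets(1)[OF assms False] assms by blast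
    then obtain x where "x \<in> K" "h \<otimes> h = x \<otimes> h" by blast
    thus False using False assms by (metis H.mem_carrier K.mem_carrier r_cancel)
  qed
qed auto

text \<open>\<open>K\<close> is normal in \<open>G\<close>: having odd order, it consists of squares of elements of \<open>H\<close>, and
  conversely all such squares lie in \<open>K\<close>.\<close>

lemma K_conj:
  assumes "x \<in> K" "a \<in> carrier G"
  shows "a \<otimes> x \<otimes> inv a \<in> K"
proof -
  define j where "j = x [^] ((p + 1) div 2)"
  have xc: "x \<in> carrier G" using assms by auto
  have "j \<in> K" unfolding j_def using assms(1)
    by (rule subgroup_pow_closed[OF K_subgroup])
  hence jH: "j \<in> H" and jc: "j \<in> carrier G" using K_sub_H by auto
  have "j \<otimes> j = x [^] ((p + 1) div 2 + (p + 1) div 2)"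
    unfolding j_def using xc by (simp add: nat_pow_mult)
  also have "(p + 1) div 2 + (p + 1) div 2 = Suc p" using odd_p by presburger
  also have "x [^] Suc p = x"
    using subgroup_pow_card[OF K_subgroup finite_K assms(1)] card_K xc by simp
  finally have jj: "j \<otimes> j = x" .
  have "a \<otimes> x \<otimes> inv a = (a \<otimes> j \<otimes> inv a) \<otimes> (a \<otimes> j \<otimes> inv a)"
  proof -
    have "(a \<otimes> j \<otimes> inv a) \<otimes> (a \<otimes> j \<otimes> inv a) = a \<otimes> j \<otimes> (inv a \<otimes> a) \<otimes> j \<otimes> inv a"
      using assms jc by (simp only: m_assoc m_closed inv_closed)
    also have "\<dots> = a \<otimes> (j \<otimes> j) \<otimes> inv a" using assms jc by (simp add: m_assoc)
    finally show ?thesis by (simp add: jj)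
  qed
  moreover have "a \<otimes> j \<otimes> inv a \<in> H" using H.inv_op_closed2 assms jH by blast
  ultimately show ?thesis using square_in_K by simp
qed

lemma K_conj_iff:
  assumes "x \<in> carrier G" "a \<in> carrier G"
  shows "a \<otimes> x \<otimes> inv a \<in> K \<longleftrightarrow> x \<in> K"
proof
  assume "a \<otimes> x \<otimes> inv a \<in> K"
  from K_conj[OF this, of "inv a"] have "inv a \<otimes> (a \<otimes> x \<otimes> inv a) \<otimes> a \<in> K" using assms by simp
  thus "x \<in> K" using assms by (simp add: m_assoc[symmetric]) (simp add: m_assoc)
qed (use K_conj assms in blast)

text \<open>The sum of \<open>s\<close> over a coset of \<open>K\<close>: a function on the quotient by \<open>K\<close>, kept as a function on
  \<open>G\<close>.\<close>

definition r :: "'a \<Rightarrow> int" where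
  "r a = (\<Sum>x\<in>K. s (x \<otimes> a))"

lemma r_left: "x \<in> K \<Longrightarrow> a \<in> carrier G \<Longrightarrow> r (x \<otimes> a) = r a"
  using sum_subgroup_right_mult[OF K_subgroup, of x "\<lambda>c. s (c \<otimes> a)"]
  by (simp add: r_def m_assoc)

lemma mult_eq_conj_mult:
  "a \<in> carrier G \<Longrightarrow> x \<in> carrier G \<Longrightarrow> a \<otimes> x = (a \<otimes> x \<otimes> inv a) \<otimes> a"
  by (simp add: m_assoc)

lemma r_right: "x \<in> K \<Longrightarrow> a \<in> carrier G \<Longrightarrow> r (a \<otimes> x) = r a"
  using mult_eq_conj_mult[of a x] r_left[OF K_conj] K.mem_carrier by metis

lemma r_inv:
  assumes a: "a \<in> carrier G"
  shows "r (inv a) = - r a"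
proof -
  have "r (inv a) = (\<Sum>x\<in>K. - s (x \<otimes> a))"
    unfolding r_def
  proof (rule sum.reindex_bij_witness[of _ "\<lambda>y. inv a \<otimes> inv y \<otimes> a" "\<lambda>x. a \<otimes> inv x \<otimes> inv a"])
    fix x assume x: "x \<in> K"
    hence xc: "x \<in> carrier G" by auto
    show "a \<otimes> inv x \<otimes> inv a \<in> K" using K_conj x a by blast
    show "inv a \<otimes> inv (a \<otimes> inv x \<otimes> inv a) \<otimes> a = x"
      using a xc by (simp add: inv_mult_group m_assoc) (simp add: m_assoc[symmetric])
    have "a \<otimes> inv x \<otimes> inv a \<otimes> a = inv (x \<otimes> inv a)" using a xc by (simp add: m_assoc inv_mult_group)
    thus "- s (a \<otimes> inv x \<otimes> inv a \<otimes> a) = s (x \<otimes> inv a)" using s_inv a xc by simp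
  next
    fix y assume y: "y \<in> K"
    hence yc: "y \<in> carrier G" by auto
    show "inv a \<otimes> inv y \<otimes> a \<in> K" using K_conj[of "inv y" "inv a"] y a by simp
    show "a \<otimes> inv (inv a \<otimes> inv y \<otimes> a) \<otimes> inv a = y"
      using a yc by (simp add: inv_mult_group m_assoc) (simp add: m_assoc[symmetric])
  qed
  thus ?thesis by (simp add: r_def sum_negf)
qed

lemma r_left_z:
  assumes "z \<in> H" "z \<notin> K" "a \<in> carrier G"
  shows "r (z \<otimes> a) = - r a"
proof -
  have zc: "z \<in> carrier G" using assms by auto
  have "0 = (\<Sum>x\<in>K \<union> (\<lambda>x. x \<otimes> z) ` K. s (x \<otimes> a))"
    using sum_s_coset[OF assms(3)] unfolding H_eq_two_cosets(1)[OF assms(1,2), symmetric] by simp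
  also have "\<dots> = r a + (\<Sum>x\<in>(\<lambda>x. x \<otimes> z) ` K. s (x \<otimes> a))"
    unfolding r_def
    by (rule sum.union_disjoint[OF finite_K finite_imageI[OF finite_K] H_eq_two_cosets(2)[OF assms(1,2)]])
  also have "(\<Sum>x\<in>(\<lambda>x. x \<otimes> z) ` K. s (x \<otimes> a)) = (\<Sum>x\<in>K. s (x \<otimes> z \<otimes> a))"
    by (simp add: sum.reindex[OF H_eq_two_cosets(3)[OF assms(1,2)]])
  also have "\<dots> = r (z \<otimes> a)"
    unfolding r_def by (intro sum.cong refl) (use assms(3) zc in \<open>simp add: m_assoc\<close>)
  finally show ?thesis by simp
qed

lemma r_right_z:
  assumes "z \<in> H" "z \<notin> K" "a \<in> carrier G"
  shows "r (a \<otimes> z) = - r a"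
proof -
  have zc: "z \<in> carrier G" using assms by auto
  have "a \<otimes> z \<otimes> inv a \<in> H" "a \<otimes> z \<otimes> inv a \<notin> K"
    using H.inv_op_closed2 K_conj_iff assms zc by auto
  from r_left_z[OF this assms(3)] show ?thesis using mult_eq_conj_mult[OF assms(3) zc] by simp
qed

lemma r_on_H: "a \<in> H \<Longrightarrow> r a = 0"
  unfolding r_def using K_sub_H s_on_H by (intro sum.neutral) auto

lemma odd_r:
  assumes "a \<in> carrier G" "a \<notin> H"
  shows "odd (r a)"
proof -
  have "odd (s (x \<otimes> a))" if "x \<in> K" for x
    using that assms notin_rcos[OF H.is_subgroup assms] K_sub_H by (intro odd_s) auto
  hence "{x \<in> K. odd (s (x \<otimes> a))} = K" by blast
  thus ?thesis unfolding r_def even_sum_iff[OF finite_K] using card_K odd_p by simp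
qed

lemma corr_r:
  assumes g: "g \<in> carrier G" "g \<notin> H"
  shows "(\<Sum>c\<in>carrier G. r c * r (g \<otimes> c)) = 0"
proof -
  have "(\<Sum>c\<in>carrier G. r c * r (g \<otimes> c))
      = (\<Sum>c\<in>carrier G. \<Sum>x\<in>K. \<Sum>y\<in>K. s (x \<otimes> c) * s ((y \<otimes> g) \<otimes> c))"
    using g by (intro sum.cong refl) (simp add: r_def sum_product m_assoc)
  also have "\<dots> = (\<Sum>x\<in>K. \<Sum>c\<in>carrier G. \<Sum>y\<in>K. s (x \<otimes> c) * s ((y \<otimes> g) \<otimes> c))"
    by (rule sum.swap)
  also have "\<dots> = (\<Sum>x\<in>K. \<Sum>y\<in>K. \<Sum>c\<in>carrier G. s (x \<otimes> c) * s ((y \<otimes> g) \<otimes> c))"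
    by (rule sum.cong[OF refl], rule sum.swap)
  also have "\<dots> = 0"
  proof (rule sum.neutral, rule ballI, rule sum.neutral, rule ballI)
    fix x y assume xy: "x \<in> K" "y \<in> K"
    hence c: "x \<in> carrier G" "y \<in> carrier G" and h: "x \<in> H" "y \<in> H" using K_sub_H by auto
    have "y \<otimes> g \<otimes> inv x \<notin> H"
    proof
      assume "y \<otimes> g \<otimes> inv x \<in> H"
      hence "inv y \<otimes> (y \<otimes> g \<otimes> inv x) \<otimes> x \<in> H" using h by blast
      moreover have "inv y \<otimes> (y \<otimes> g \<otimes> inv x) \<otimes> x = g"
        using c g by (simp add: m_assoc) (simp add: m_assoc[symmetric])
      ultimately show False using g by simp
    qed
    moreover from this have "y \<otimes> g \<otimes> inv x \<noteq> \<one>" by auto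
    ultimately show "(\<Sum>c\<in>carrier G. s (x \<otimes> c) * s ((y \<otimes> g) \<otimes> c)) = 0"
      using c g corr_double_shift[of x "y \<otimes> g"] corr_eq[of "y \<otimes> g \<otimes> inv x"] by simp
  qed
  finally show ?thesis .
qed

text \<open>A left \<open>M\<close>-invariant system \<open>R\<close> of half of the elements of \<open>G\<close>, complementary to \<open>Rz\<close>. It is
  \<open>M \<union> Mx\<close> for any \<open>x\<close> outside of \<open>MH = M \<union> Mz\<close>.\<close>

lemma obtain_half:
  obtains z R where "z \<in> H" "z \<notin> K" "M \<subseteq> R" "R \<inter> H = K" "card R = 2 * p ^ 2"
    "\<And>m c. m \<in> M \<Longrightarrow> c \<in> R \<Longrightarrow> m \<otimes> c \<in> R"
    "R \<inter> (\<lambda>c. c \<otimes> z) ` R = {}" "carrier G = R \<union> (\<lambda>c. c \<otimes> z) ` R"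
proof -
  have "card K < card H" using card_K card_H p_gt_2 by simp
  then obtain z where z: "z \<in> H" "z \<notin> K"
    by (metis card_mono finite_K not_le subsetI)
  have zc: "z \<in> carrier G" using z by auto
  have "card (M \<union> (\<lambda>m. m \<otimes> z) ` M) \<le> p ^ 2 + p ^ 2"
    using card_Un_le[of M "(\<lambda>m. m \<otimes> z) ` M"] card_image_le[OF finite_M, of "\<lambda>m. m \<otimes> z"] card_M
    by simp
  moreover have "0 < p ^ 2" using p_gt_2 by simp
  ultimately have "card (M \<union> (\<lambda>m. m \<otimes> z) ` M) < card (carrier G)"
    using order_v v_p by linarith
  then obtain x where x: "x \<in> carrier G" "x \<notin> M" "x \<notin> (\<lambda>m. m \<otimes> z) ` M"
    using card_mono[of "M \<union> (\<lambda>m. m \<otimes> z) ` M" "carrier G"] finite_M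
    by (metis UnCI finite_UnI finite_imageI not_le subsetI)
  have x_MH: "x \<noteq> m \<otimes> h" if "m \<in> M" "h \<in> H" for m h
  proof
    assume eq: "x = m \<otimes> h"
    from that(2) consider "h \<in> K" | k' where "k' \<in> K" "h = k' \<otimes> z" using H_eq_two_cosets(1)[OF z] by blast
    thus False
    proof cases
      case 1
      thus False using x(2) eq that(1) K_sub_M by auto
    next
      case 2
      hence "x = (m \<otimes> k') \<otimes> z" "m \<otimes> k' \<in> M" using eq that(1) zc K_sub_M by (auto simp: m_assoc)
      thus False using x(3) by blast
    qed
  qed

  define R where "R = M \<union> (\<lambda>m. m \<otimes> x) ` M"
  have R_sub: "R \<subseteq> carrier G" using x by (auto simp: R_def)
  have finR: "finite R" using finite_M by (simp add: R_def)
  have injx: "inj_on (\<lambda>m. m \<otimes> x) M" using inj_on_multc[OF x(1)] M.subset inj_on_subset by blast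
  have "M \<inter> (\<lambda>m. m \<otimes> x) ` M = {}" using notin_rcos[OF M_subgroup x(1,2)] by auto
  from card_Un_disjoint[OF finite_M finite_imageI[OF finite_M] this]
  have card_R: "card R = 2 * p ^ 2"
    unfolding R_def using card_image[OF injx] card_M by simp
  have R_left: "m \<otimes> c \<in> R" if "m \<in> M" "c \<in> R" for m c
    using that x(1) unfolding R_def by (auto simp: m_assoc[symmetric])
  have R_H: "c \<in> M" if cR: "c \<in> R" and cH: "c \<in> H" for c
  proof (rule ccontr)
    assume "c \<notin> M"
    then obtain m where m: "m \<in> M" "c = m \<otimes> x" using cR by (auto simp: R_def)
    hence "x = inv m \<otimes> c" using x(1) by (simp add: m_assoc[symmetric])
    thus False using x_MH[of "inv m" c] m cH by blast
  qed

  have disj: "R \<inter> (\<lambda>c. c \<otimes> z) ` R = {}"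
  proof -
    have False if c: "c \<in> R" "c' \<in> R" and eq: "c = c' \<otimes> z" for c c'
    proof -
      have xz: "x \<otimes> z \<otimes> inv x \<in> H" "x \<otimes> z \<otimes> inv x \<notin> K"
        using H.inv_op_closed2 K_conj_iff z zc x(1) by auto
      have xzM: "x \<otimes> z \<otimes> inv x \<notin> M" using xz by (auto simp: K_def)
      have zM: "z \<notin> M" using z by (auto simp: K_def)
      from c consider (1) "c \<in> M" "c' \<in> M"
        | (2) m' where "c \<in> M" "m' \<in> M" "c' = m' \<otimes> x"
        | (3) m where "m \<in> M" "c = m \<otimes> x" "c' \<in> M"
        | (4) m m' where "m \<in> M" "m' \<in> M" "c = m \<otimes> x" "c' = m' \<otimes> x"
        unfolding R_def by blast
      thus False
      proof cases
        case 1
        thus False using notin_rcos[OF M_subgroup zc zM] eq by blast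
      next
        case 2
        have "inv m' \<otimes> c \<otimes> inv z = inv m' \<otimes> (m' \<otimes> x \<otimes> z) \<otimes> inv z" using eq 2 by simp
        also have "\<dots> = x" using 2 x(1) zc by (simp add: m_assoc) (simp add: m_assoc[symmetric])
        finally show False using x_MH[of "inv m' \<otimes> c" "inv z"] 2 z by auto
      next
        case 3
        have "inv m \<otimes> c' \<otimes> z = inv m \<otimes> (m \<otimes> x)" using eq 3 zc by (simp add: m_assoc)
        also have "\<dots> = x" using 3 x(1) by (simp add: m_assoc[symmetric])
        finally show False using x_MH[of "inv m \<otimes> c'" z] 3 z by auto
      next
        case 4
        have "m' \<otimes> (x \<otimes> z \<otimes> inv x) = m \<otimes> x \<otimes> inv x" using eq 4 x(1) zc by (simp add: m_assoc)
        also have "\<dots> = m" using 4 x(1) by (simp add: m_assoc)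
        finally show False
          using notin_rcos[OF M_subgroup _ xzM 4(2)] 4(1) x(1) zc by auto
      qed
    qed
    thus ?thesis by blast
  qed
  have injz: "inj_on (\<lambda>c. c \<otimes> z) R" using inj_on_multc[OF zc] R_sub inj_on_subset by blast
  have "card (R \<union> (\<lambda>c. c \<otimes> z) ` R) = card (carrier G)"
    using card_Un_disjoint[OF finR _ disj] finR card_image[OF injz] card_R order_v v_p by simp
  moreover have "R \<union> (\<lambda>c. c \<otimes> z) ` R \<subseteq> carrier G" using R_sub zc by auto
  ultimately have G_eq: "carrier G = R \<union> (\<lambda>c. c \<otimes> z) ` R"
    using card_subset_eq[OF fin] by metis
  have "M \<subseteq> R" by (simp add: R_def)
  moreover from this have "R \<inter> H = K" using R_H by (auto simp: K_def)
  ultimately show thesis using that[of z R] z card_R R_left disj G_eq by blast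
qed

text \<open>The autocorrelation of \<open>r\<close> at an element of \<open>M - K\<close> vanishes, yet it is congruent to \<open>4\<close>
  modulo \<open>8\<close>: twice a sum over \<open>R\<close> that is congruent to \<open>2\<close> modulo \<open>4\<close>.\<close>

lemma no_drad_of_order_four_p_square: False
proof -
  obtain z R where z: "z \<in> H" "z \<notin> K" and M_R: "M \<subseteq> R" and R_H: "R \<inter> H = K"
    and card_R: "card R = 2 * p ^ 2"
    and R_left: "\<And>m c. m \<in> M \<Longrightarrow> c \<in> R \<Longrightarrow> m \<otimes> c \<in> R"
    and disj: "R \<inter> (\<lambda>c. c \<otimes> z) ` R = {}" and G_eq: "carrier G = R \<union> (\<lambda>c. c \<otimes> z) ` R"
    using obtain_half by blast
  have zc: "z \<in> carrier G" using z by auto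
  have R_sub: "R \<subseteq> carrier G" using G_eq by blast
  have finR: "finite R" using R_sub fin finite_subset by blast
  have injz: "inj_on (\<lambda>c. c \<otimes> z) R" using inj_on_multc[OF zc] R_sub inj_on_subset by blast
  have K_R: "K \<subseteq> R" using M_R K_sub_M by blast
  have "card K < card M" using card_K card_M p_gt_2 by (simp add: power2_eq_square)
  then obtain g where g: "g \<in> M" "g \<notin> K"
    by (metis card_mono finite_K not_le subsetI)
  have gc: "g \<in> carrier G" using g by auto
  have gH: "g \<notin> H" using g by (auto simp: K_def)

  have "0 = (\<Sum>c\<in>R \<union> (\<lambda>c. c \<otimes> z) ` R. r c * r (g \<otimes> c))"
    using corr_r[OF gc gH] G_eq by simp
  also have "\<dots> = (\<Sum>c\<in>R. r c * r (g \<otimes> c)) + (\<Sum>c\<in>R. r (c \<otimes> z) * r (g \<otimes> (c \<otimes> z)))"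
    using disj finR injz by (simp add: sum.union_disjoint sum.reindex)
  also have "(\<Sum>c\<in>R. r (c \<otimes> z) * r (g \<otimes> (c \<otimes> z))) = (\<Sum>c\<in>R. r c * r (g \<otimes> c))"
  proof (rule sum.cong[OF refl])
    fix c assume "c \<in> R"
    hence c: "c \<in> carrier G" using R_sub by blast
    have "r (c \<otimes> z) = - r c" using r_right_z[OF z c] .
    moreover have "r (g \<otimes> (c \<otimes> z)) = - r (g \<otimes> c)"
      using r_right_z[OF z, of "g \<otimes> c"] c gc zc by (simp add: m_assoc)
    ultimately show "r (c \<otimes> z) * r (g \<otimes> (c \<otimes> z)) = r c * r (g \<otimes> c)" by simp
  qed
  finally have zero: "(\<Sum>c\<in>R. r c * r (g \<otimes> c)) = 0" by simp

  have shift: "(\<Sum>c\<in>R. f (g \<otimes> c)) = (\<Sum>c\<in>R. f c)" for f :: "'a \<Rightarrow> int"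
  proof (rule sum.reindex_bij_witness[of _ "\<lambda>c. inv g \<otimes> c" "\<lambda>c. g \<otimes> c"])
    fix c assume "c \<in> R"
    moreover from this have "c \<in> carrier G" using R_sub by blast
    ultimately show "inv g \<otimes> (g \<otimes> c) = c" "g \<otimes> c \<in> R" "g \<otimes> (inv g \<otimes> c) = c" "inv g \<otimes> c \<in> R"
      using gc g(1) R_left by (auto simp: m_assoc[symmetric])
  qed auto

  \<comment> \<open>\<open>e c\<close> is \<open>r c * r (g c)\<close> minus an expression congruent to it modulo \<open>4\<close> that is easy to sum
    over \<open>R\<close>; the last two terms account for the zeros of \<open>r\<close>, using \<open>r (g c) = r g\<close> if \<open>c \<in> K\<close> and \<open>r c = - r g\<close> if \<open>g c \<in> K\<close>.\<close>
  define e where "e c = r c * r (g \<otimes> c) - (r c + r (g \<otimes> c) - 1)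
    - of_bool (c \<in> K) * (1 - r g) - of_bool (g \<otimes> c \<in> K) * (1 + r g)" for c
  have "4 dvd e c" if c: "c \<in> R" for c
  proof -
    have cc: "c \<in> carrier G" using c R_sub by blast
    have gcK: "c \<in> K \<Longrightarrow> g \<otimes> c \<notin> K"
      by (metis K.m_closed K.m_inv_closed K.mem_carrier g(2) gc inv_solve_right m_closed)
    consider "c \<in> K" | "g \<otimes> c \<in> K" | "c \<notin> K" "g \<otimes> c \<notin> K" by blast
    thus ?thesis
    proof cases
      case 1
      hence "r c = 0" "r (g \<otimes> c) = r g" using r_on_H K_sub_H r_right gc by auto
      thus ?thesis using 1 gcK by (simp add: e_def)
    next
      case 2
      have "r (inv g \<otimes> (g \<otimes> c)) = r (inv g)" using r_right[OF 2] gc by simp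
      hence "r c = - r g" using gc cc r_inv by (simp add: m_assoc[symmetric])
      moreover have "r (g \<otimes> c) = 0" using r_on_H K_sub_H 2 by auto
      ultimately show ?thesis using 2 gcK by (auto simp: e_def)
    next
      case 3
      hence "odd (r c)" "odd (r (g \<otimes> c))"
        using odd_r R_H c R_left[OF g(1) c] cc gc by auto
      hence "2 * 2 dvd (r c - 1) * (r (g \<otimes> c) - 1)" by (intro mult_dvd_mono) auto
      thus ?thesis using 3 by (simp add: e_def algebra_simps)
    qed
  qed
  hence "4 dvd (\<Sum>c\<in>R. e c)" by (rule dvd_sum)
  moreover have sum_K: "(\<Sum>c\<in>R. of_bool (c \<in> K)) = int p"
    using K_R finR card_K by (simp add: Int_absorb1 flip: of_nat_sum)
  have "(\<Sum>c\<in>R. e c) = (\<Sum>c\<in>R. r c * r (g \<otimes> c)) - ((\<Sum>c\<in>R. r c) + (\<Sum>c\<in>R. r (g \<otimes> c)) - int (card R))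
      - (\<Sum>c\<in>R. of_bool (c \<in> K)) * (1 - r g) - (\<Sum>c\<in>R. of_bool (g \<otimes> c \<in> K)) * (1 + r g)"
    by (simp add: e_def sum.distrib sum_subtractf sum_distrib_right)
  also have "\<dots> = 2 * (int p ^ 2 - int p - (\<Sum>c\<in>R. r c))"
    unfolding shift[of r] shift[of "\<lambda>c. of_bool (c \<in> K)"] zero sum_K card_R
    by (simp add: algebra_simps)
  ultimately have "2 * 2 dvd 2 * (int p ^ 2 - int p - (\<Sum>c\<in>R. r c))" by simp
  hence "even (int p ^ 2 - int p - (\<Sum>c\<in>R. r c))" by (simp only: dvd_mult_cancel_left) simp
  hence "even (\<Sum>c\<in>R. r c)" using odd_p by simp
  moreover have "odd (r c) \<longleftrightarrow> c \<notin> K" if "c \<in> R" for c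
    using that odd_r[of c] r_on_H[of c] K_sub_H[of c] R_H R_sub by (cases "c \<in> H") auto
  hence "{c \<in> R. odd (r c)} = R - K" by blast
  moreover have "card (R - K) = 2 * p ^ 2 - p"
    using card_Diff_subset[OF finite_K K_R] card_R card_K by simp
  moreover have "odd (2 * p ^ 2 - p)"
    using odd_p p_gt_2 by (simp add: power2_eq_square)
  ultimately show False using even_sum_iff[OF finR, of r] by simp
qed

end

theorem theorem1p2:
  fixes G :: "('a, 'b) monoid_scheme" and p :: nat
  assumes "Factorial_Ring.prime p" and "odd p"
    and "group G" and "Coset.order G = 4 * p ^ 2"
  shows "\<not> DRAD_difference_set_group G"
proof
  assume "DRAD_difference_set_group G"
  then obtain v k l H D where drad: "DRAD_difference_set G v k l H D"
    unfolding DRAD_difference_set_group_def by blast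
  interpret drad G v k l H D
    using assms(3) drad by (simp add: drad_def drad_axioms_def)
  obtain M where M: "subgroup M G" "card M = p ^ 2"
    using sylow_thm[OF assms(1,3), of 2 4] assms(4) fin by (auto simp: mult.commute)
  interpret drad_four_p_square G v k l H D p M
    using assms M order_v drad_axioms
    by (simp add: drad_four_p_square_def drad_four_p_square_axioms_def Coset.order_def)
  show False by (rule no_drad_of_order_four_p_square)
qed

end
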